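(* Let $\nu>2$ and let $(\Theta_{i1},\Theta_{i2})$, $i=1,2,\dots$, be i.i.d., where $\Theta_{i1}=(\Theta_{i1}^x,\Theta_{i1}^y)$ is bivariate normal with means $\mu_x,\mu_y$, variances $\sigma_x^2,\sigma_y^2$ and correlation $\rho$, $\Theta_{i2}=(\Theta_{i2}^x,\Theta_{i2}^y,\Theta_{i2}^{xy})$ has the bivariate Wishart distribution with $\nu$ degrees of freedom and parameters $\gamma_1,\gamma_2,\gamma_3$, and $\Theta_{i1}$ and $\Theta_{i2}$ are independent. Let $\hat\mu_x,\hat\mu_y,\hat\sigma_x^2,\hat\sigma_y^2,\hat\rho,\hat\gamma_1,\hat\gamma_2,\hat\gamma_3$ be the maximum likelihood estimators based on $i=1,\dots,n$ given in the context. Then, as $n\to\infty$, with convergence in probability: (a) $\hat\mu_x\to\mu_x$ and $\hat\mu_y\to\mu_y$; (b) $\hat\sigma_x^2\to\sigma_x^2$, $\hat\sigma_y^2\to\sigma_y^2$, and $\hat\rho\to\rho$; (c) $\hat\gamma_1\to\gamma_1$, $\hat\gamma_2\to\gamma_2$, and $\hat\gamma_3\to\gamma_3$.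
   Context: Parameters satisfy $\mu_x,\mu_y\in\mathbb{R}$, $\sigma_x,\sigma_y>0$, $|\rho|<1$, $\gamma_1,\gamma_2>0$, $\gamma_1\gamma_2>\gamma_3^2$. The bivariate Wishart distribution with $\nu$ degrees of freedom and parameters $\gamma_1,\gamma_2,\gamma_3$ is the law of $(s,t,r)$ such that $\begin{pmatrix}s&r\\ r&t\end{pmatrix}$ is Wishart distributed with $\nu$ degrees of freedom and scale matrix $\begin{pmatrix}\gamma_1&\gamma_3\\ \gamma_3&\gamma_2\end{pmatrix}$, i.e. with density on $\{s,t>0,\ r^2<st\}$ $$\frac{(\gamma_1\gamma_2-\gamma_3^2)^{-\nu/2}}{2^\nu\sqrt{\pi}\,\Gamma(\frac{\nu}{2})\Gamma(\frac{\nu-1}{2})}(st-r^2)^{\frac{\nu-3}{2}}\exp\left\{-\frac{\gamma_1\gamma_2}{2(\gamma_1\gamma_2-\gamma_3^2)}\left(\frac{s}{\gamma_1}+\frac{t}{\gamma_2}-\frac{2\gamma_3 r}{\gamma_1\gamma_2}\right)\right\}.$$ The estimators are $\hat\mu_x=\frac1n\sum_{i=1}^n\Theta_{i1}^x$, $\hat\mu_y=\frac1n\sum_{i=1}^n\Theta_{i1}^y$, $\hat\sigma_x^2=\frac1n\sum_{i=1}^n(\Theta_{i1}^x-\hat\mu_x)^2$, $\hat\sigma_y^2=\frac1n\sum_{i=1}^n(\Theta_{i1}^y-\hat\mu_y)^2$, $\hat\rho=\frac{\sum_{i=1}^n(\Theta_{i1}^y-\hat\mu_y)(\Theta_{i1}^x-\hat\mu_x)}{\left(\sum_{i=1}^n(\Theta_{i1}^y-\hat\mu_y)^2\sum_{i=1}^n(\Theta_{i1}^x-\hat\mu_x)^2\right)^{1/2}}$,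 $\hat\gamma_1=\frac1{n\nu}\sum_{i=1}^n\Theta_{i2}^x$, $\hat\gamma_2=\frac1{n\nu}\sum_{i=1}^n\Theta_{i2}^y$, $\hat\gamma_3=\frac1{n\nu}\sum_{i=1}^n\Theta_{i2}^{xy}$. *)

theory Defs
  imports "HOL-Probability.Probability"
begin

definition bivariate_normal_density ::
    "real \<Rightarrow> real \<Rightarrow> real \<Rightarrow> real \<Rightarrow> real \<Rightarrow> real \<times> real \<Rightarrow> real" where
  "bivariate_normal_density \<mu>x \<mu>y \<sigma>x \<sigma>y \<rho> = (\<lambda>(x, y).
     1 / (2 * pi * \<sigma>x * \<sigma>y * sqrt (1 - \<rho>\<^sup>2)) *
     exp (- 1 / (2 * (1 - \<rho>\<^sup>2)) *
       ((x - \<mu>x)\<^sup>2 / \<sigma>x\<^sup>2 + (y - \<mu>y)\<^sup>2 / \<sigma>y\<^sup>2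
        - 2 * \<rho> * (x - \<mu>x) * (y - \<mu>y) / (\<sigma>x * \<sigma>y))))"

text \<open>
  The Wishart matrix with diagonal entries \<open>s\<close>, \<open>t\<close> and off-diagonal entry \<open>r\<close> is encoded
  as the triple \<open>(s, t, r)\<close>, and the density is taken with respect to Lebesgue measure in these
  three coordinates. The degrees of freedom \<open>\<nu>\<close> need not be an integer.
\<close>

definition bivariate_wishart_density ::
    "real \<Rightarrow> real \<Rightarrow> real \<Rightarrow> real \<Rightarrow> real \<times> real \<times> real \<Rightarrow> real" where
  "bivariate_wishart_density \<nu> \<gamma>1 \<gamma>2 \<gamma>3 = (\<lambda>(s, t, r).
     if 0 < s \<and> 0 < t \<and> r\<^sup>2 < s * t then
       (\<gamma>1 * \<gamma>2 - \<gamma>3\<^sup>2) powr (- \<nu> / 2)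
         / (2 powr \<nu> * sqrt pi * Gamma (\<nu> / 2) * Gamma ((\<nu> - 1) / 2))
       * (s * t - r\<^sup>2) powr ((\<nu> - 3) / 2)
       * exp (- (\<gamma>1 * \<gamma>2 / (2 * (\<gamma>1 * \<gamma>2 - \<gamma>3\<^sup>2))
                * (s / \<gamma>1 + t / \<gamma>2 - 2 * \<gamma>3 * r / (\<gamma>1 * \<gamma>2))))
     else 0)"

text \<open>
  \<^const>\<open>prob_space.indep_var\<close> forces both random variables to have the same codomain
  type; this is the same notion (independence of the generated sigma-algebras) for two different
  codomain types.
\<close>

definition independent_pair ::
    "'a measure \<Rightarrow> 'b measure \<Rightarrow> ('a \<Rightarrow> 'b) \<Rightarrow> 'c measure \<Rightarrow> ('a \<Rightarrow> 'c) \<Rightarrow> bool" where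
  "independent_pair M S X T Y \<longleftrightarrow>
     X \<in> measurable M S \<and> Y \<in> measurable M T \<and>
     prob_space.indep_set M {X -` A \<inter> space M | A. A \<in> sets S} {Y -` B \<inter> space M | B. B \<in> sets T}"

text \<open>
  Samples are indexed from \<open>1\<close>, and every estimator is a function of the sample size and the
  outcome \<open>\<omega>\<close>. At degenerate arguments (\<open>n = 0\<close>, or a vanishing sample variance in the
  correlation) the estimators take the value \<open>0\<close> because \<open>x / 0 = 0\<close>.
\<close>

definition mean_hat :: "(nat \<Rightarrow> 'a \<Rightarrow> real) \<Rightarrow> nat \<Rightarrow> 'a \<Rightarrow> real" where
  "mean_hat X n \<omega> = 1 / real n * (\<Sum>i=1..n. X i \<omega>)"

definition variance_hat :: "(nat \<Rightarrow> 'a \<Rightarrow> real) \<Rightarrow> nat \<Rightarrow> 'a \<Rightarrow> real" where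
  "variance_hat X n \<omega> = 1 / real n * (\<Sum>i=1..n. (X i \<omega> - mean_hat X n \<omega>)\<^sup>2)"

definition correlation_hat ::
    "(nat \<Rightarrow> 'a \<Rightarrow> real) \<Rightarrow> (nat \<Rightarrow> 'a \<Rightarrow> real) \<Rightarrow> nat \<Rightarrow> 'a \<Rightarrow> real" where
  "correlation_hat X Y n \<omega> =
     (\<Sum>i=1..n. (Y i \<omega> - mean_hat Y n \<omega>) * (X i \<omega> - mean_hat X n \<omega>))
     / sqrt ((\<Sum>i=1..n. (Y i \<omega> - mean_hat Y n \<omega>)\<^sup>2) * (\<Sum>i=1..n. (X i \<omega> - mean_hat X n \<omega>)\<^sup>2))"

definition wishart_scale_hat :: "real \<Rightarrow> (nat \<Rightarrow> 'a \<Rightarrow> real) \<Rightarrow> nat \<Rightarrow> 'a \<Rightarrow> real" where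
  "wishart_scale_hat \<nu> X n \<omega> = 1 / (real n * \<nu>) * (\<Sum>i=1..n. X i \<omega>)"

text \<open>
  Measurability is part of the definition, since the measure of a non-measurable
  set is \<open>0\<close> by convention.
\<close>

definition converges_in_probability ::
    "'a measure \<Rightarrow> (nat \<Rightarrow> 'a \<Rightarrow> real) \<Rightarrow> ('a \<Rightarrow> real) \<Rightarrow> bool" where
  "converges_in_probability M X L \<longleftrightarrow>
     (\<forall>n. X n \<in> borel_measurable M) \<and> L \<in> borel_measurable M \<and>
     (\<forall>\<epsilon>>0. (\<lambda>n. measure M {\<omega> \<in> space M. \<bar>X n \<omega> - L \<omega>\<bar> > \<epsilon>}) \<longlonglongrightarrow> 0)"

end

theory Submission
  imports Defs
begin

text \<open>
  Every estimator is a continuous function of sample means of square-integrable functions of the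
  observations, so the weak law of large numbers (by Chebyshev) and continuous mapping reduce the
  claim to moments. Both laws have the shape "second coordinate conditionally normal, with mean
  affine in the first": for the bivariate normal law the first coordinate is normal, and for the
  pair of a diagonal entry and the off-diagonal entry of the Wishart matrix the first coordinate is
  gamma distributed. The constant of that gamma density is never simplified: the law has total mass
  one by assumption, and this determines it.
\<close>

subsection \<open>Convergence in probability\<close>

text \<open>The weak law needs the second moment of an averaged function to be finite and the same
  for every index, but not its value: equality of the densities supplies a common value, and only
  the means of the averaged functions have to be computed. Finiteness comes from domination where
  direct integration would be longer: the squared product of the normal coordinates is bounded by
  their fourth powers, and the squared off-diagonal Wishart entry by the squares of the diagonal
  entries, because the determinant is positive on the support. The conditional normal shape is
  therefore used only for marginals and for conditional means, never for conditional variances. The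
  Wishart triple is nested as \<open>(s, (t, r))\<close>, so integrating out its first coordinate
  leaves the law of \<open>(t, r)\<close>. This is why the off-diagonal entry is conditioned on the
  second diagonal entry.\<close>

text \<open>Continuity is asked only at the limit point, which admits division at a nonzero
  denominator; since this does not give measurability of \<open>f\<close>, that is assumed
  separately. Unary maps are covered by ignoring one argument.\<close>

lemma converges_in_probability_continuous2:
  fixes f :: "real \<Rightarrow> real \<Rightarrow> real"
  assumes "prob_space M"
    and X: "converges_in_probability M X (\<lambda>_. a)" and Y: "converges_in_probability M Y (\<lambda>_. b)"
    and f: "case_prod f \<in> borel_measurable borel"
    and cont: "isCont (case_prod f) (a, b)"
  shows "converges_in_probability M (\<lambda>n \<omega>. f (X n \<omega>) (Y n \<omega>)) (\<lambda>_. f a b)"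
proof -
  interpret prob_space M by fact
  have [measurable]: "X n \<in> borel_measurable M" "Y n \<in> borel_measurable M" for n
    using X Y by (auto simp: converges_in_probability_def)
  have fXY[measurable]: "(\<lambda>\<omega>. f (X n \<omega>) (Y n \<omega>)) \<in> borel_measurable M" for n
    using measurable_compose[OF _ f, of "\<lambda>\<omega>. (X n \<omega>, Y n \<omega>)" M] by simp
  have "(\<lambda>n. prob {\<omega> \<in> space M. \<bar>f (X n \<omega>) (Y n \<omega>) - f a b\<bar> > \<epsilon>}) \<longlonglongrightarrow> 0" if "\<epsilon> > 0" for \<epsilon>
  proof -
    from cont that obtain d where d: "d > 0"
      "\<And>z. dist z (a, b) < d \<Longrightarrow> dist (case_prod f z) (f a b) < \<epsilon>"
      unfolding continuous_at_eps_delta by (auto simp: dist_commute)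
    \<comment> \<open>Off both exceptional events each deviation is at most \<open>d / 4\<close>, so
      the Euclidean distance is at most the sum \<open>d / 2\<close>, strictly below
      \<open>d\<close>.\<close>
    define A where "A n = {\<omega> \<in> space M. \<bar>X n \<omega> - a\<bar> > d / 4}" for n
    define B where "B n = {\<omega> \<in> space M. \<bar>Y n \<omega> - b\<bar> > d / 4}" for n
    have [measurable]: "A n \<in> sets M" "B n \<in> sets M" for n
      by (auto simp: A_def B_def)
    have "{\<omega> \<in> space M. \<bar>f (X n \<omega>) (Y n \<omega>) - f a b\<bar> > \<epsilon>} \<subseteq> A n \<union> B n" for n
    proof (rule subsetI, rule ccontr)
      fix \<omega> assume 1: "\<omega> \<in> {\<omega> \<in> space M. \<bar>f (X n \<omega>) (Y n \<omega>) - f a b\<bar> > \<epsilon>}" and 2: "\<omega> \<notin> A n \<union> B n"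
      then have "\<bar>X n \<omega> - a\<bar> \<le> d / 4" "\<bar>Y n \<omega> - b\<bar> \<le> d / 4"
        by (auto simp: A_def B_def)
      then have "dist (X n \<omega>, Y n \<omega>) (a, b) < d"
        using d(1) sqrt_sum_squares_le_sum_abs[of "X n \<omega> - a" "Y n \<omega> - b"]
        by (simp add: dist_Pair_Pair dist_real_def)
      with d(2) 1 show False by (force simp: dist_real_def)
    qed
    then have "prob {\<omega> \<in> space M. \<bar>f (X n \<omega>) (Y n \<omega>) - f a b\<bar> > \<epsilon>} \<le> prob (A n) + prob (B n)" for n
      by (intro order_trans[OF finite_measure_mono measure_Un_le]) auto
    moreover have "(\<lambda>n. prob (A n) + prob (B n)) \<longlonglongrightarrow> 0 + 0"
      using X Y half_gt_zero[OF half_gt_zero[OF d(1)]]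
      unfolding converges_in_probability_def A_def B_def
      by (intro tendsto_add) (simp_all del: divide_less_eq_numeral1)
    ultimately show ?thesis
      by (auto intro: Lim_null_comparison[where g = "\<lambda>n. prob (A n) + prob (B n)"])
  qed
  then show ?thesis by (simp add: converges_in_probability_def)
qed

section \<open>The weak law of large numbers\<close>

lemma (in prob_space) weak_law_of_large_numbers:
  fixes X :: "nat \<Rightarrow> 'a \<Rightarrow> real"
  assumes indep: "indep_vars (\<lambda>_. borel) X {1..}"
    and int2: "\<And>i. i \<ge> 1 \<Longrightarrow> integrable M (\<lambda>\<omega>. (X i \<omega>)\<^sup>2)"
    and second: "\<And>i. i \<ge> 1 \<Longrightarrow> expectation (\<lambda>\<omega>. (X i \<omega>)\<^sup>2) = q"
    and mean: "\<And>i. i \<ge> 1 \<Longrightarrow> expectation (X i) = m"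
  shows "converges_in_probability M (mean_hat X) (\<lambda>_. m)"
proof -
  have rv: "X i \<in> borel_measurable M" if "i \<ge> 1" for i
    using indep that by (auto simp: indep_vars_def2)
  have int1: "integrable M (X i)" if "i \<ge> 1" for i
    using square_integrable_imp_integrable[OF rv int2] that by blast
  have meas[measurable]: "mean_hat X n \<in> borel_measurable M" for n
    unfolding mean_hat_def by (intro borel_measurable_times borel_measurable_sum rv) auto
  define Z where "Z i \<omega> = X i \<omega> - m" for i \<omega>
  have indepZ: "indep_vars (\<lambda>_. borel) Z {1..}"
    unfolding Z_def using indep by (rule indep_vars_compose2) auto
  have Z1: "integrable M (Z i)" "expectation (Z i) = 0" if "i \<ge> 1" for i
    using that int1 mean by (auto simp: Z_def[abs_def] prob_space)
  \<comment> \<open>Squares are written as products so that diagonal and mixed terms have one form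
    in the double sum expanding the squared deviation of the sample mean.\<close>
  have Z2: "integrable M (\<lambda>\<omega>. Z i \<omega> * Z i \<omega>)" "expectation (\<lambda>\<omega>. Z i \<omega> * Z i \<omega>) = q - m\<^sup>2" if "i \<ge> 1" for i
  proof -
    have *: "(\<lambda>\<omega>. Z i \<omega> * Z i \<omega>) = (\<lambda>\<omega>. (X i \<omega>)\<^sup>2 - 2 * m * X i \<omega> + m\<^sup>2)"
      by (simp add: Z_def power2_eq_square algebra_simps)
    show "integrable M (\<lambda>\<omega>. Z i \<omega> * Z i \<omega>)"
      unfolding * using that int1 int2 by auto
    show "expectation (\<lambda>\<omega>. Z i \<omega> * Z i \<omega>) = q - m\<^sup>2"
      unfolding * using that int1 int2 mean second by (simp add: prob_space power2_eq_square)
  qed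
  have ZZ: "integrable M (\<lambda>\<omega>. Z i \<omega> * Z j \<omega>)" "expectation (\<lambda>\<omega>. Z i \<omega> * Z j \<omega>) = 0"
    if "i \<noteq> j" "i \<ge> 1" "j \<ge> 1" for i j
  proof -
    have I: "indep_vars (\<lambda>_. borel) Z {i, j}"
      using indepZ by (rule indep_vars_subset) (use that in auto)
    have Z: "\<And>k. k \<in> {i, j} \<Longrightarrow> integrable M (Z k)" using Z1 that by auto
    show "integrable M (\<lambda>\<omega>. Z i \<omega> * Z j \<omega>)"
      using indep_vars_integrable[OF _ I Z] that by simp
    show "expectation (\<lambda>\<omega>. Z i \<omega> * Z j \<omega>) = 0"
      using indep_vars_lebesgue_integral[OF _ I Z] that Z1 by simp
  qed
  have ZZ_int: "integrable M (\<lambda>\<omega>. Z i \<omega> * Z j \<omega>)" if "i \<ge> 1" "j \<ge> 1" for i j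
    using Z2(1) ZZ(1) that by (cases "i = j") auto
  \<comment> \<open>The case \<open>n = 0\<close> is excluded: there the right-hand side is 0 by
    division by zero, while the event may have probability 1.\<close>
  have bound: "prob {\<omega> \<in> space M. \<bar>mean_hat X n \<omega> - m\<bar> > \<epsilon>} \<le> (q - m\<^sup>2) / \<epsilon>\<^sup>2 / real n"
    if "\<epsilon> > 0" "n \<ge> 1" for n \<epsilon>
  proof -
    have eq: "mean_hat X n \<omega> - m = (\<Sum>i=1..n. Z i \<omega>) / n" for \<omega>
      using \<open>n \<ge> 1\<close> by (simp add: mean_hat_def Z_def sum_subtractf field_simps)
    have sq: "(mean_hat X n \<omega> - m)\<^sup>2 = (\<Sum>i=1..n. \<Sum>j=1..n. Z i \<omega> * Z j \<omega>) / (real n)\<^sup>2" for \<omega>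
      by (simp add: eq power2_eq_square sum_product)
    have int: "integrable M (\<lambda>\<omega>. (mean_hat X n \<omega> - m)\<^sup>2)"
      unfolding sq by (intro integrable_divide Bochner_Integration.integrable_sum ZZ_int) auto
    have "expectation (\<lambda>\<omega>. \<Sum>i=1..n. \<Sum>j=1..n. Z i \<omega> * Z j \<omega>)
        = (\<Sum>i=1..n. expectation (\<lambda>\<omega>. \<Sum>j=1..n. Z i \<omega> * Z j \<omega>))"
      by (rule Bochner_Integration.integral_sum) (auto intro!: Bochner_Integration.integrable_sum ZZ_int)
    also have "\<dots> = (\<Sum>i=1..n. \<Sum>j=1..n. expectation (\<lambda>\<omega>. Z i \<omega> * Z j \<omega>))"
      by (intro sum.cong refl Bochner_Integration.integral_sum ZZ_int) auto
    \<comment> \<open>Distinct centred variables are uncorrelated, so only the \<open>n\<close>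
      diagonal terms survive; division by the square of \<open>n\<close> leaves a variance of order
      \<open>1 / n\<close>.\<close>
    also have "(\<Sum>i=1..n. \<Sum>j=1..n. expectation (\<lambda>\<omega>. Z i \<omega> * Z j \<omega>))
        = (\<Sum>i=1..n. \<Sum>j=1..n. if i = j then q - m\<^sup>2 else 0)"
      using ZZ Z2 by (intro sum.cong) auto
    also have "\<dots> = n * (q - m\<^sup>2)" by simp
    finally have var: "expectation (\<lambda>\<omega>. (mean_hat X n \<omega> - m)\<^sup>2) = (q - m\<^sup>2) / n"
      using \<open>n \<ge> 1\<close> unfolding sq by (simp add: power2_eq_square)
    have "prob {\<omega> \<in> space M. \<bar>mean_hat X n \<omega> - m\<bar> > \<epsilon>}
       \<le> prob {\<omega> \<in> space M. \<bar>mean_hat X n \<omega> - m\<bar> \<ge> \<epsilon>}"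
      by (intro finite_measure_mono) auto
    also have "\<dots> \<le> expectation (\<lambda>\<omega>. (mean_hat X n \<omega> - m)\<^sup>2) / \<epsilon>\<^sup>2"
      using int \<open>\<epsilon> > 0\<close> by (intro second_moment_method) auto
    finally show ?thesis by (simp add: var mult.commute)
  qed
  have "(\<lambda>n. prob {\<omega> \<in> space M. \<bar>mean_hat X n \<omega> - m\<bar> > \<epsilon>}) \<longlonglongrightarrow> 0" if "\<epsilon> > 0" for \<epsilon>
  proof (rule tendsto_sandwich[OF _ _ tendsto_const])
    show "\<forall>\<^sub>F n in sequentially. prob {\<omega> \<in> space M. \<bar>mean_hat X n \<omega> - m\<bar> > \<epsilon>} \<le> (q - m\<^sup>2) / \<epsilon>\<^sup>2 / real n"
      using bound[OF that] eventually_ge_at_top by (rule eventually_mono[rotated])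
    show "(\<lambda>n. (q - m\<^sup>2) / \<epsilon>\<^sup>2 / real n) \<longlonglongrightarrow> 0"
      by (rule lim_const_over_n)
  qed auto
  then show ?thesis by (simp add: converges_in_probability_def)
qed

section \<open>The estimators as functions of sample means\<close>

text \<open>The common source of both second-order estimators: taking \<open>Y = X\<close> gives the
  variance, and the order of the factors copies the numerator of
  \<open>correlation_hat\<close>.\<close>

definition covariance_hat :: "(nat \<Rightarrow> 'a \<Rightarrow> real) \<Rightarrow> (nat \<Rightarrow> 'a \<Rightarrow> real) \<Rightarrow> nat \<Rightarrow> 'a \<Rightarrow> real" where
  "covariance_hat X Y n \<omega> = 1 / real n * (\<Sum>i=1..n. (Y i \<omega> - mean_hat Y n \<omega>) * (X i \<omega> - mean_hat X n \<omega>))"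

lemma covariance_hat_eq:
  "covariance_hat X Y n \<omega> = mean_hat (\<lambda>i \<omega>. X i \<omega> * Y i \<omega>) n \<omega> - mean_hat X n \<omega> * mean_hat Y n \<omega>"
proof (cases "n = 0")
  case False
  let ?a = "mean_hat X n \<omega>" and ?b = "mean_hat Y n \<omega>"
  have s: "(\<Sum>i=1..n. X i \<omega>) = n * ?a" "(\<Sum>i=1..n. Y i \<omega>) = n * ?b"
    using False by (auto simp: mean_hat_def)
  have "(\<Sum>i=1..n. (Y i \<omega> - ?b) * (X i \<omega> - ?a))
      = (\<Sum>i=1..n. X i \<omega> * Y i \<omega>) - ?b * (\<Sum>i=1..n. X i \<omega>) - ?a * (\<Sum>i=1..n. Y i \<omega>) + n * ?a * ?b"
    by (simp add: algebra_simps sum.distrib sum_subtractf sum_distrib_left)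
  also have "\<dots> = (\<Sum>i=1..n. X i \<omega> * Y i \<omega>) - n * ?a * ?b"
    unfolding s by (simp add: algebra_simps)
  finally show ?thesis
    using False by (simp add: covariance_hat_def mean_hat_def[of "\<lambda>i \<omega>. X i \<omega> * Y i \<omega>"] field_simps)
qed (simp add: covariance_hat_def mean_hat_def)

lemma variance_hat_eq: "variance_hat X = covariance_hat X X"
  by (simp add: fun_eq_iff variance_hat_def covariance_hat_def power2_eq_square)

text \<open>The normalisations \<open>1 / n\<close> cancel between numerator and root, so the
  correlation becomes a function of quantities that have limits. For \<open>n = 0\<close> both sides
  are 0.\<close>

lemma correlation_hat_eq:
  "correlation_hat X Y n \<omega> = covariance_hat X Y n \<omega> / sqrt (variance_hat Y n \<omega> * variance_hat X n \<omega>)"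
proof (cases "n = 0")
  case False
  have "sqrt (1 / real n * a * (1 / real n * b)) = 1 / real n * sqrt (a * b)" for a b
    by (simp add: real_sqrt_mult real_sqrt_divide)
  with False show ?thesis
    by (simp add: correlation_hat_def covariance_hat_def variance_hat_def)
qed (simp add: correlation_hat_def covariance_hat_def)

text \<open>Identical distribution enters here: the second moment of \<open>h (\<Theta> i)\<close>
  is an integral against the common density, hence independent of \<open>i\<close>, and this
  integral serves as the constant \<open>q\<close> of the weak law.\<close>

lemma (in prob_space) sample_mean_consistent:
  fixes h :: "'b \<Rightarrow> real"
  assumes D: "\<And>i. i \<ge> 1 \<Longrightarrow> distributed M N (\<Theta> i) f"
    and h: "h \<in> borel_measurable N"
    and indep: "indep_vars (\<lambda>_. borel) (\<lambda>i \<omega>. h (\<Theta> i \<omega>)) {1..}"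
    and int: "\<And>i. i \<ge> 1 \<Longrightarrow> integrable M (\<lambda>\<omega>. (h (\<Theta> i \<omega>))\<^sup>2)"
    and mean: "\<And>i. i \<ge> 1 \<Longrightarrow> expectation (\<lambda>\<omega>. h (\<Theta> i \<omega>)) = m"
  shows "converges_in_probability M (mean_hat (\<lambda>i \<omega>. h (\<Theta> i \<omega>))) (\<lambda>_. m)"
proof (rule weak_law_of_large_numbers[OF indep int _ mean])
  fix i :: nat assume i: "i \<ge> 1"
  have "expectation (\<lambda>\<omega>. (h (\<Theta> i \<omega>))\<^sup>2) = (\<integral>x. (h x)\<^sup>2 \<partial>distr M N (\<Theta> i))"
    using h by (intro integral_distr[symmetric] distributed_measurable[OF D[OF i]]) simp
  then show "expectation (\<lambda>\<omega>. (h (\<Theta> i \<omega>))\<^sup>2) = (\<integral>x. (h x)\<^sup>2 \<partial>density N f)"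
    by (simp add: distributed_distr_eq_density[OF D[OF i]])
qed

lemma converges_in_probability_covariance_hat:
  assumes "prob_space M"
    and "converges_in_probability M (mean_hat (\<lambda>i \<omega>. X i \<omega> * Y i \<omega>)) (\<lambda>_. c)"
    and X: "converges_in_probability M (mean_hat X) (\<lambda>_. a)"
    and Y: "converges_in_probability M (mean_hat Y) (\<lambda>_. b)"
  shows "converges_in_probability M (covariance_hat X Y) (\<lambda>_. c - a * b)"
proof -
  have "converges_in_probability M (\<lambda>n \<omega>. mean_hat X n \<omega> * mean_hat Y n \<omega>) (\<lambda>_. a * b)"
    by (rule converges_in_probability_continuous2[OF assms(1) X Y])
      (auto simp: case_prod_unfold borel_prod[symmetric] intro!: continuous_intros)
  from converges_in_probability_continuous2[OF assms(1,2) this, of "(-)"]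
  show ?thesis
    by (auto simp: case_prod_unfold covariance_hat_eq[abs_def] borel_prod[symmetric] intro!: continuous_intros)
qed

text \<open>\<open>sqrt\<close> is continuous on the whole real line, so the only constraint is at
  the division, where the limit \<open>sqrt (w * v)\<close> is nonzero because \<open>v\<close> and
  \<open>w\<close> are.\<close>

lemma converges_in_probability_correlation_hat:
  assumes M: "prob_space M"
    and XY: "converges_in_probability M (covariance_hat X Y) (\<lambda>_. c)"
    and X: "converges_in_probability M (variance_hat X) (\<lambda>_. v)"
    and Y: "converges_in_probability M (variance_hat Y) (\<lambda>_. w)"
    and "v \<noteq> 0" "w \<noteq> 0"
  shows "converges_in_probability M (correlation_hat X Y) (\<lambda>_. c / sqrt (w * v))"
proof -
  have "converges_in_probability M (\<lambda>n \<omega>. sqrt (variance_hat Y n \<omega> * variance_hat X n \<omega>)) (\<lambda>_. sqrt (w * v))"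
    by (rule converges_in_probability_continuous2[OF M Y X])
      (auto simp: case_prod_unfold borel_prod[symmetric] intro!: continuous_intros)
  from converges_in_probability_continuous2[OF M XY this, of "(/)"] assms(5,6)
  show ?thesis
    by (auto simp: case_prod_unfold correlation_hat_eq[abs_def] borel_prod[symmetric] intro!: continuous_intros)
qed

lemma converges_in_probability_wishart_scale_hat:
  assumes M: "prob_space M" and X: "converges_in_probability M (mean_hat X) (\<lambda>_. \<nu> * \<gamma>)" and "\<nu> \<noteq> 0"
  shows "converges_in_probability M (wishart_scale_hat \<nu> X) (\<lambda>_. \<gamma>)"
  using converges_in_probability_continuous2[OF M X X, of "\<lambda>x _. x / \<nu>"] \<open>\<nu> \<noteq> 0\<close>
  by (auto simp: case_prod_unfold wishart_scale_hat_def[abs_def] mean_hat_def[abs_def] borel_prod[symmetric]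
      intro!: continuous_intros)

subsection \<open>Conditionally normal pairs and the bivariate normal law\<close>

text \<open>Integrating out the second coordinate gives 1 for the normal factor and its mean for the
  factor times \<open>r\<close>; with Fubini the latter is the tower property. The spread
  \<open>\<tau>\<close> may depend on \<open>s\<close>: it is constant for the bivariate normal law
  and proportional to the root of \<open>s\<close> for the Wishart law. In the latter case it is not
  positive for \<open>s \<le> 0\<close>, so positivity is required only where \<open>g\<close> does
  not vanish.\<close>

lemma (in prob_space)
  fixes S R :: "'a \<Rightarrow> real"
  assumes D: "distributed M lborel (\<lambda>\<omega>. (S \<omega>, R \<omega>))
      (\<lambda>z. ennreal (g (fst z) * normal_density (a + m * fst z) (\<tau> (fst z)) (snd z)))"
    and g: "\<And>s. 0 \<le> g s" and \<tau>: "\<And>s. g s \<noteq> 0 \<Longrightarrow> 0 < \<tau> s"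
  shows conditional_normal_marginal: "distributed M lborel S (\<lambda>s. ennreal (g s))"
    and conditional_normal_expectation:
      "\<lbrakk>h \<in> borel_measurable borel; integrable M (\<lambda>\<omega>. h (S \<omega>) * R \<omega>)\<rbrakk> \<Longrightarrow>
        expectation (\<lambda>\<omega>. h (S \<omega>) * R \<omega>) = expectation (\<lambda>\<omega>. h (S \<omega>) * (a + m * S \<omega>))"
proof -
  let ?p = "\<lambda>z. g (fst z) * normal_density (a + m * fst z) (\<tau> (fst z)) (snd z)"
  have D': "distributed M (lborel \<Otimes>\<^sub>M lborel) (\<lambda>\<omega>. (S \<omega>, R \<omega>)) (\<lambda>z. ennreal (?p z))"
    using D by (simp add: lborel_prod)
  have p: "0 \<le> ?p z" for z using g by simp
  have one: "(\<integral>\<^sup>+r. ennreal (?p (s, r)) \<partial>lborel) = ennreal (g s)" for s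
  proof (cases "g s = 0")
    case False
    have "(\<integral>\<^sup>+r. ennreal (?p (s, r)) \<partial>lborel) =
      ennreal (g s) * (\<integral>\<^sup>+r. ennreal (normal_density (a + m * s) (\<tau> s) r) \<partial>lborel)"
      using g by (simp add: ennreal_mult nn_integral_cmult)
    also have "(\<integral>\<^sup>+r. ennreal (normal_density (a + m * s) (\<tau> s) r) \<partial>lborel) = 1"
      using \<tau>[OF False] by (subst nn_integral_eq_integral) auto
    finally show ?thesis by simp
  qed simp
  show marg: "distributed M lborel S (\<lambda>s. ennreal (g s))"
    using distr_marginal1[OF _ _ D'] by (simp only: one lborel.sigma_finite_measure_axioms)
  assume h[measurable]: "h \<in> borel_measurable borel" and int: "integrable M (\<lambda>\<omega>. h (S \<omega>) * R \<omega>)"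
  have hm: "(\<lambda>z. h (fst z) * snd z) \<in> borel_measurable (lborel \<Otimes>\<^sub>M lborel)"
    by measurable
  have int': "integrable (lborel \<Otimes>\<^sub>M lborel) (\<lambda>z. ?p z * (h (fst z) * snd z))"
    using distributed_integrable[OF D' hm p] int by simp
  have inner: "(\<integral>r. ?p (s, r) * (h s * r) \<partial>lborel) = g s * (h s * (a + m * s))" for s
  proof (cases "g s = 0")
    case False
    have "(\<integral>r. ?p (s, r) * (h s * r) \<partial>lborel) =
       (\<integral>r. g s * h s * (normal_density (a + m * s) (\<tau> s) r * r) \<partial>lborel)"
      by (simp add: ac_simps)
    also have "\<dots> = g s * h s * (a + m * s)"
      using integral_normal_moment_nz_1[OF \<tau>[OF False]] by simp
    finally show ?thesis by (simp add: ac_simps)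
  qed simp
  have "expectation (\<lambda>\<omega>. h (S \<omega>) * R \<omega>) = (\<integral>z. ?p z * (h (fst z) * snd z) \<partial>(lborel \<Otimes>\<^sub>M lborel))"
    using distributed_integral[OF D' hm p] by simp
  also have "\<dots> = (\<integral>s. (\<integral>r. ?p (s, r) * (h s * r) \<partial>lborel) \<partial>lborel)"
    using lborel_pair.integral_fst'[OF int'] by simp
  also have "\<dots> = (\<integral>s. g s * (h s * (a + m * s)) \<partial>lborel)"
    unfolding inner ..
  also have "\<dots> = expectation (\<lambda>\<omega>. h (S \<omega>) * (a + m * S \<omega>))"
    by (rule distributed_integral[OF marg]) (auto simp: g)
  finally show "expectation (\<lambda>\<omega>. h (S \<omega>) * R \<omega>) = expectation (\<lambda>\<omega>. h (S \<omega>) * (a + m * S \<omega>))" .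
qed

section \<open>The bivariate normal law\<close>

lemma bivariate_normal_density_commute:
  "bivariate_normal_density \<mu>x \<mu>y \<sigma>x \<sigma>y \<rho> (x, y) = bivariate_normal_density \<mu>y \<mu>x \<sigma>y \<sigma>x \<rho> (y, x)"
  by (simp add: bivariate_normal_density_def algebra_simps)

text \<open>Completing the square in standardised coordinates \<open>u\<close>, \<open>v\<close>:
  the quadratic form equals
  \<open>(1 - \<rho>\<^sup>2) * u\<^sup>2 + (v - \<rho> * u)\<^sup>2\<close>. The slope
  \<open>\<rho> * \<sigma>y / \<sigma>x\<close> is that of the regression line, and the constant and
  linear terms of the conditional mean are kept apart to match the affine shape used above.\<close>

lemma bivariate_normal_density_conditional:
  assumes "\<sigma>x > 0" "\<sigma>y > 0" "\<bar>\<rho>\<bar> < 1"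
  shows "bivariate_normal_density \<mu>x \<mu>y \<sigma>x \<sigma>y \<rho> z = normal_density \<mu>x \<sigma>x (fst z) *
    normal_density (\<mu>y - \<rho> * \<sigma>y / \<sigma>x * \<mu>x + \<rho> * \<sigma>y / \<sigma>x * fst z) (\<sigma>y * sqrt (1 - \<rho>\<^sup>2)) (snd z)"
proof -
  obtain x y where z: "z = (x, y)" by force
  define k where "k = 1 - \<rho>\<^sup>2"
  have k: "k > 0" using assms(3) by (simp add: k_def abs_square_less_1)
  define u where "u = (x - \<mu>x) / \<sigma>x"
  define v where "v = (y - \<mu>y) / \<sigma>y"
  have xy: "x = \<mu>x + \<sigma>x * u" "y = \<mu>y + \<sigma>y * v"
    using assms by (simp_all add: u_def v_def)
  have res: "y - (\<mu>y - \<rho> * \<sigma>y / \<sigma>x * \<mu>x + \<rho> * \<sigma>y / \<sigma>x * x) = \<sigma>y * (v - \<rho> * u)"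
    using assms by (simp add: xy field_simps)
  have "sqrt (2 * pi * \<sigma>x\<^sup>2) * sqrt (2 * pi * (\<sigma>y * sqrt k)\<^sup>2)
      = 2 * pi * \<sigma>x * \<sigma>y * sqrt k"
    unfolding real_sqrt_mult[symmetric] using assms k
    by (intro real_sqrt_unique) (simp_all add: power_mult_distrib power2_eq_square)
  then have c: "1 / sqrt (2 * pi * \<sigma>x\<^sup>2) * (1 / sqrt (2 * pi * (\<sigma>y * sqrt k)\<^sup>2))
      = 1 / (2 * pi * \<sigma>x * \<sigma>y * sqrt k)"
    by simp
  have "- 1 / (2 * k) * (u\<^sup>2 + v\<^sup>2 - 2 * \<rho> * u * v) = - u\<^sup>2 / 2 - (v - \<rho> * u)\<^sup>2 / (2 * k)"
  proof -
    have "u\<^sup>2 + v\<^sup>2 - 2 * \<rho> * u * v = k * u\<^sup>2 + (v - \<rho> * u)\<^sup>2"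
      by (simp add: k_def power2_eq_square algebra_simps)
    then show ?thesis using k by (simp add: field_simps)
  qed
  also have "\<dots> = - (x - \<mu>x)\<^sup>2 / (2 * \<sigma>x\<^sup>2) + - (\<sigma>y * (v - \<rho> * u))\<^sup>2 / (2 * (\<sigma>y * sqrt k)\<^sup>2)"
    using assms k by (simp add: xy power_mult_distrib)
  finally have e: "exp (- 1 / (2 * k) * (u\<^sup>2 + v\<^sup>2 - 2 * \<rho> * u * v)) =
     exp (- (x - \<mu>x)\<^sup>2 / (2 * \<sigma>x\<^sup>2)) * exp (- (\<sigma>y * (v - \<rho> * u))\<^sup>2 / (2 * (\<sigma>y * sqrt k)\<^sup>2))"
    by (simp only: exp_add)
  have "(x - \<mu>x)\<^sup>2 / \<sigma>x\<^sup>2 + (y - \<mu>y)\<^sup>2 / \<sigma>y\<^sup>2 - 2 * \<rho> * (x - \<mu>x) * (y - \<mu>y) / (\<sigma>x * \<sigma>y)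
     = u\<^sup>2 + v\<^sup>2 - 2 * \<rho> * u * v"
    using assms by (simp add: u_def v_def power_divide)
  then show ?thesis
    unfolding bivariate_normal_density_def normal_density_def z
    by (simp only: prod.case fst_conv snd_conv res k_def[symmetric] e c[symmetric]) (simp only: mult_ac)
qed

text \<open>Central moments of the normal density are finite, and the binomial expansion of
  \<open>((X - \<mu>) + \<mu>) ^ k\<close> reduces raw moments to them.\<close>

lemma (in prob_space) normal_power_integrable:
  assumes D: "distributed M lborel X (\<lambda>x. ennreal (normal_density \<mu> \<sigma> x))" and \<sigma>: "\<sigma> > 0"
  shows "integrable M (\<lambda>\<omega>. X \<omega> ^ k)"
proof -
  have "integrable M (\<lambda>\<omega>. (X \<omega> - \<mu>) ^ i)" for i
    using distributed_integrable[OF D, of "\<lambda>x. (x - \<mu>) ^ i"] integrable_normal_moment[OF \<sigma>] by simp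
  then have "integrable M (\<lambda>\<omega>. \<Sum>i\<le>k. of_nat (k choose i) * (X \<omega> - \<mu>) ^ i * \<mu> ^ (k - i))"
    by (intro Bochner_Integration.integrable_sum integrable_mult_left integrable_mult_right)
  then show ?thesis
    by (simp flip: binomial_ring)
qed

lemma (in prob_space)
  assumes D: "distributed M lborel (\<lambda>\<omega>. (X \<omega>, Y \<omega>)) (\<lambda>z. ennreal (bivariate_normal_density \<mu>x \<mu>y \<sigma>x \<sigma>y \<rho> z))"
    and \<sigma>: "\<sigma>x > 0" "\<sigma>y > 0" and \<rho>: "\<bar>\<rho>\<bar> < 1"
  shows bivariate_normal_marginals:
      "distributed M lborel X (\<lambda>x. ennreal (normal_density \<mu>x \<sigma>x x))"
      "distributed M lborel Y (\<lambda>y. ennreal (normal_density \<mu>y \<sigma>y y))"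
    and bivariate_normal_product_square_integrable: "integrable M (\<lambda>\<omega>. (X \<omega> * Y \<omega>)\<^sup>2)"
    and bivariate_normal_product_expectation: "expectation (\<lambda>\<omega>. X \<omega> * Y \<omega>) = \<rho> * \<sigma>x * \<sigma>y + \<mu>x * \<mu>y"
proof -
  note cond = D[unfolded bivariate_normal_density_conditional[OF \<sigma> \<rho>]]
  have \<tau>: "\<sigma> * sqrt (1 - \<rho>\<^sup>2) > 0" if "\<sigma> > 0" for \<sigma>
    using \<rho> that by (simp add: abs_square_less_1)
  show X: "distributed M lborel X (\<lambda>x. ennreal (normal_density \<mu>x \<sigma>x x))"
    by (rule conditional_normal_marginal[OF cond]) (use \<tau> \<sigma> in auto)
  \<comment> \<open>The density is invariant under exchanging the coordinates together with their
    parameters, so the other marginal follows from the same factorisation.\<close>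
  have "distributed M lborel (\<lambda>\<omega>. (Y \<omega>, X \<omega>)) (\<lambda>z. ennreal (bivariate_normal_density \<mu>y \<mu>x \<sigma>y \<sigma>x \<rho> z))"
    using distributed_swap[OF lborel.sigma_finite_measure_axioms lborel.sigma_finite_measure_axioms
        D[folded lborel_prod]]
    by (simp add: lborel_prod bivariate_normal_density_commute[of \<mu>x] case_prod_unfold)
  note cond' = this[unfolded bivariate_normal_density_conditional[OF \<sigma>(2,1) \<rho>]]
  show Y: "distributed M lborel Y (\<lambda>y. ennreal (normal_density \<mu>y \<sigma>y y))"
    by (rule conditional_normal_marginal[OF cond']) (use \<tau> \<sigma> in auto)
  note intX = normal_power_integrable[OF X \<sigma>(1)] and intY = normal_power_integrable[OF Y \<sigma>(2)]
  have [measurable]: "X \<in> borel_measurable M" "Y \<in> borel_measurable M"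
    using distributed_measurable[OF X] distributed_measurable[OF Y] by simp_all
  \<comment> \<open>This domination needs only the fourth moments of the marginals, not the joint
    law.\<close>
  have bound: "(x * y)\<^sup>2 \<le> x ^ 4 + y ^ 4" for x y :: real
  proof -
    have "(x * y)\<^sup>2 \<le> 2 * (x * y)\<^sup>2" by simp
    also have "\<dots> \<le> (x\<^sup>2)\<^sup>2 + (y\<^sup>2)\<^sup>2"
      using sum_squares_bound[of "x\<^sup>2" "y\<^sup>2"] by (simp add: power_mult_distrib)
    finally show ?thesis by simp
  qed
  show XY2: "integrable M (\<lambda>\<omega>. (X \<omega> * Y \<omega>)\<^sup>2)"
    by (rule Bochner_Integration.integrable_bound[of _ "\<lambda>\<omega>. X \<omega> ^ 4 + Y \<omega> ^ 4"])
      (use intX intY bound in auto)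
  have XY: "integrable M (\<lambda>\<omega>. X \<omega> * Y \<omega>)"
    by (rule square_integrable_imp_integrable[OF _ XY2]) simp
  have EX: "expectation X = \<mu>x" "expectation (\<lambda>\<omega>. (X \<omega>)\<^sup>2) = \<sigma>x\<^sup>2 + \<mu>x\<^sup>2"
    using normal_distributed_expectation[OF \<sigma>(1) X] normal_distributed_variance[OF \<sigma>(1) X]
      variance_eq[of X] intX[of 1] intX[of 2] by auto
  let ?m = "\<rho> * \<sigma>y / \<sigma>x"
  \<comment> \<open>Conditioning on \<open>X\<close> replaces \<open>Y\<close> by its regression on
    \<open>X\<close>, which leaves the first two moments of \<open>X\<close>.\<close>
  have "expectation (\<lambda>\<omega>. X \<omega> * Y \<omega>) = expectation (\<lambda>\<omega>. X \<omega> * (\<mu>y - ?m * \<mu>x + ?m * X \<omega>))"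
    by (rule conditional_normal_expectation[OF cond, of "\<lambda>x. x"]) (use \<tau> \<sigma> XY in auto)
  also have "\<dots> = expectation (\<lambda>\<omega>. (\<mu>y - ?m * \<mu>x) * X \<omega> + ?m * (X \<omega>)\<^sup>2)"
    by (simp add: algebra_simps power2_eq_square)
  also have "\<dots> = (\<mu>y - ?m * \<mu>x) * \<mu>x + ?m * (\<sigma>x\<^sup>2 + \<mu>x\<^sup>2)"
    using intX[of 1] intX[of 2] by (simp add: EX)
  also have "\<dots> = \<rho> * \<sigma>x * \<sigma>y + \<mu>x * \<mu>y"
    using \<sigma> by (simp add: field_simps power2_eq_square)
  finally show "expectation (\<lambda>\<omega>. X \<omega> * Y \<omega>) = \<rho> * \<sigma>x * \<sigma>y + \<mu>x * \<mu>y" .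
qed

subsection \<open>The gamma law and the bivariate Wishart law\<close>

text \<open>Substituting \<open>t = b * s\<close> in Euler's integral: the power contributes
  \<open>b powr (a - 1)\<close> and the Jacobian one more factor \<open>b\<close>. The nonnegative
  integral yields value and integrability together.\<close>

lemma nn_integral_gamma_kernel:
  assumes "a > 0" "b > 0"
  shows "(\<integral>\<^sup>+s. ennreal (if 0 < s then s powr (a - 1) * exp (- (b * s)) else 0) \<partial>lborel)
    = ennreal (Gamma a / b powr a)" (is "?I = _")
proof -
  let ?f = "\<lambda>s. if 0 < s then s powr (a - 1) * exp (- (b * s)) else 0"
  have [measurable]: "?f \<in> borel_measurable borel" by measurable
  have "ennreal (Gamma a) = (\<integral>\<^sup>+t. ennreal (indicator {0..} t * t powr (a - 1) / exp t) \<partial>lborel)"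
    by (rule Gamma_conv_nn_integral_real) fact
  also have "\<dots> = ennreal \<bar>b\<bar> * (\<integral>\<^sup>+s. ennreal (indicator {0..} (0 + b * s) * (0 + b * s) powr (a - 1) / exp (0 + b * s)) \<partial>lborel)"
    using assms by (intro nn_integral_real_affine) auto
  also have "\<dots> = ennreal b * (\<integral>\<^sup>+s. ennreal (b powr (a - 1)) * ennreal (?f s) \<partial>lborel)"
    using assms
    by (intro arg_cong2[where f="(*)"] nn_integral_cong)
      (auto simp: ennreal_mult[symmetric] powr_mult exp_minus field_simps zero_le_mult_iff not_less
        indicator_def)
  also have "\<dots> = ennreal (b powr a) * ?I"
    using assms
    by (subst nn_integral_cmult) (auto simp: mult.assoc[symmetric] ennreal_mult[symmetric] powr_mult_base)
  finally have "ennreal (1 / b powr a) * ennreal (Gamma a) = ennreal (1 / b powr a) * (ennreal (b powr a) * ?I)"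
    by simp
  then show ?thesis
    using assms by (simp add: mult.assoc[symmetric] ennreal_mult[symmetric])
qed

text \<open>Multiplying the density by \<open>s ^ k\<close> shifts the shape from \<open>a\<close>
  to \<open>a + k\<close>, so every moment is one gamma integral. The mean is the first moment over
  the zeroth, evaluated by the recurrence of \<open>Gamma\<close>.\<close>

lemma (in prob_space)
  fixes S :: "'a \<Rightarrow> real"
  assumes D: "distributed M lborel S
      (\<lambda>s. ennreal (if 0 < s then C * s powr (a - 1) * exp (- (b * s)) else 0))"
    and a: "a > 0" and b: "b > 0" and C: "C \<ge> 0"
  shows gamma_power_integrable: "integrable M (\<lambda>\<omega>. S \<omega> ^ k)"
    and gamma_expectation: "expectation S = a / b"
proof -
  let ?g = "\<lambda>s. if 0 < s then C * s powr (a - 1) * exp (- (b * s)) else 0"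
  have g: "0 \<le> ?g s" for s using C by auto
  have "has_bochner_integral lborel (\<lambda>s. ?g s * s ^ k) (C * (Gamma (a + k) / b powr (a + k)))" for k :: nat
  proof (rule has_bochner_integral_nn_integral)
    have "ennreal (?g s * s ^ k)
       = ennreal C * ennreal (if 0 < s then s powr (a + k - 1) * exp (- (b * s)) else 0)" for s
      using C by (auto simp: ennreal_mult[symmetric] powr_realpow[symmetric] powr_add[symmetric] algebra_simps)
    then show "(\<integral>\<^sup>+s. ennreal (?g s * s ^ k) \<partial>lborel) = ennreal (C * (Gamma (a + k) / b powr (a + k)))"
      using a b C by (simp add: nn_integral_cmult nn_integral_gamma_kernel ennreal_mult' flip: times_divide_eq_right)
    show "0 \<le> C * (Gamma (a + k) / b powr (a + k))"
      using C a less_imp_le[OF Gamma_real_pos[of "a + k"]] by simp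
  qed (use C in auto)
  note * = has_bochner_integral_integral_eq[OF this] integrable.intros[OF this]
  show "integrable M (\<lambda>\<omega>. S \<omega> ^ k)"
    using distributed_integrable[OF D, of "\<lambda>s. s ^ k"] g *(2) by simp
  have E: "expectation (\<lambda>\<omega>. S \<omega> ^ k) = C * (Gamma (a + k) / b powr (a + k))" for k
    using distributed_integral[OF D, of "\<lambda>s. s ^ k"] g *(1)[of k] by simp
  have "a \<notin> \<int>\<^sub>\<le>\<^sub>0" using a by (auto elim: nonpos_Ints_cases)
  moreover have "expectation S = C * (Gamma (a + 1) / b powr (a + 1))"
    using E[of 1] by simp
  ultimately have "expectation S = a / b * (C * (Gamma a / b powr a))"
    using b by (simp add: Gamma_plus1 powr_add mult_ac)
  \<comment> \<open>The zeroth moment is the total mass.\<close>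
  also have "C * (Gamma a / b powr a) = 1"
    using E[of 0] by (simp add: prob_space del: divide_eq_eq_1 eq_divide_eq_1 one_eq_divide_iff)
  finally show "expectation S = a / b" by simp
qed

section \<open>The bivariate Wishart law\<close>

text \<open>The three factors are the Wishart normaliser, the gamma integral over the Schur
  complement, and the reciprocal of the normal normaliser without its root of \<open>s\<close>. For
  admissible parameters the product is the gamma normaliser
  \<open>1 / (Gamma (\<nu> / 2) * (2 * \<gamma>1) powr (\<nu> / 2))\<close>.\<close>

definition wishart_marginal_const :: "real \<Rightarrow> real \<Rightarrow> real \<Rightarrow> real \<Rightarrow> real" where
  "wishart_marginal_const \<nu> \<gamma>1 \<gamma>2 \<gamma>3 =
     (\<gamma>1 * \<gamma>2 - \<gamma>3\<^sup>2) powr (- \<nu> / 2)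
       / (2 powr \<nu> * sqrt pi * Gamma (\<nu> / 2) * Gamma ((\<nu> - 1) / 2))
     * (Gamma ((\<nu> - 1) / 2) / (\<gamma>1 / (2 * (\<gamma>1 * \<gamma>2 - \<gamma>3\<^sup>2))) powr ((\<nu> - 1) / 2))
     * sqrt (2 * pi * (\<gamma>1 * \<gamma>2 - \<gamma>3\<^sup>2) / \<gamma>1)"

lemma bivariate_wishart_density_commute:
  "bivariate_wishart_density \<nu> \<gamma>1 \<gamma>2 \<gamma>3 (s, t, r) = bivariate_wishart_density \<nu> \<gamma>2 \<gamma>1 \<gamma>3 (t, s, r)"
  by (simp add: bivariate_wishart_density_def mult.commute conj_commute add.commute)

text \<open>The substitution \<open>t = r\<^sup>2 / s + u\<close> (the Schur complement \<open>u\<close>) factors the density into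
  a gamma kernel in \<open>s\<close>, a gamma kernel in \<open>u\<close>, and a normal density in \<open>r\<close> with mean
  \<open>\<gamma>3 / \<gamma>1 * s\<close> and variance \<open>(\<gamma>1 * \<gamma>2 - \<gamma>3\<^sup>2) * s / \<gamma>1\<close>.\<close>

lemma nn_integral_bivariate_wishart_density:
  assumes \<gamma>: "\<gamma>1 > 0" "\<gamma>2 > 0" "\<gamma>1 * \<gamma>2 > \<gamma>3\<^sup>2" and \<nu>: "\<nu> > 1"
  shows "(\<integral>\<^sup>+t. ennreal (bivariate_wishart_density \<nu> \<gamma>1 \<gamma>2 \<gamma>3 (s, t, r)) \<partial>lborel) =
    ennreal ((if 0 < s then wishart_marginal_const \<nu> \<gamma>1 \<gamma>2 \<gamma>3 * s powr (\<nu> / 2 - 1) * exp (- (1 / (2 * \<gamma>1) * s)) else 0)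
      * normal_density (\<gamma>3 / \<gamma>1 * s) (sqrt ((\<gamma>1 * \<gamma>2 - \<gamma>3\<^sup>2) * s / \<gamma>1)) r)"
proof (cases "0 < s")
  case False
  then show ?thesis by (simp add: bivariate_wishart_density_def)
next
  case s: True
  define D where "D = \<gamma>1 * \<gamma>2 - \<gamma>3\<^sup>2"
  have D: "D > 0" using \<gamma> by (simp add: D_def)
  define c where "c = D powr (- \<nu> / 2) / (2 powr \<nu> * sqrt pi * Gamma (\<nu> / 2) * Gamma ((\<nu> - 1) / 2))"
  have c: "c \<ge> 0" using \<nu> by (simp add: c_def less_imp_le)
  \<comment> \<open>\<open>w\<close> is minus the exponent of the normal density in
    \<open>r\<close>, \<open>K\<close> collects everything free of \<open>u\<close>, and
    \<open>b\<close> is the rate of the gamma kernel in \<open>u\<close>.\<close>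
  define w where "w = (r - \<gamma>3 / \<gamma>1 * s)\<^sup>2 / (2 * (D * s / \<gamma>1))"
  define K where "K = c * s powr ((\<nu> - 3) / 2) * exp (- (1 / (2 * \<gamma>1) * s)) * exp (- w)"
  have K: "K \<ge> 0" using c by (simp add: K_def)
  define b where "b = \<gamma>1 / (2 * D)"
  have b: "b > 0" using \<gamma> D by (simp add: b_def)
  let ?k = "\<lambda>u. if 0 < u then u powr ((\<nu> - 1) / 2 - 1) * exp (- (b * u)) else 0"
  have meas: "(\<lambda>t. ennreal (bivariate_wishart_density \<nu> \<gamma>1 \<gamma>2 \<gamma>3 (s, t, r))) \<in> borel_measurable borel"
    unfolding bivariate_wishart_density_def by simp
  \<comment> \<open>In the new coordinate the determinant is \<open>s * u\<close>, so the support
    condition becomes \<open>0 < u\<close> and the power splits. The factor in \<open>1 * u\<close>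
    is the slope of the affine substitution.\<close>
  have eq: "bivariate_wishart_density \<nu> \<gamma>1 \<gamma>2 \<gamma>3 (s, r\<^sup>2 / s + 1 * u, r) = K * ?k u" for u
  proof -
    have det: "s * (r\<^sup>2 / s + u) - r\<^sup>2 = s * u"
      using s by (simp add: field_simps)
    show ?thesis
    proof (cases "0 < u")
      case True
      have pos: "0 < r\<^sup>2 / s + u"
        using s True by (simp add: add_nonneg_pos)
      have "0 < s * (r\<^sup>2 / s + u) - r\<^sup>2"
        unfolding det using s True by simp
      then have det_pos: "r\<^sup>2 < s * (r\<^sup>2 / s + u)"
        by (simp only: diff_gt_0_iff_gt)
      have "\<gamma>1 * \<gamma>2 / (2 * D) * (s / \<gamma>1 + (r\<^sup>2 / s + u) / \<gamma>2 - 2 * \<gamma>3 * r / (\<gamma>1 * \<gamma>2))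
          = (\<gamma>2 * s + \<gamma>1 * r\<^sup>2 / s + \<gamma>1 * u - 2 * \<gamma>3 * r) / (2 * D)"
        using \<gamma> D s by (simp add: field_simps)
      \<comment> \<open>This split completes the square in \<open>r\<close>: the second summand
        joins the terms in \<open>r\<close> to form
        \<open>\<gamma>1 / s * (r - \<gamma>3 / \<gamma>1 * s)\<^sup>2\<close>, and the first leaves
        the gamma exponent in \<open>s\<close>.\<close>
      also have "\<gamma>2 * s = D / \<gamma>1 * s + \<gamma>3\<^sup>2 / \<gamma>1 * s"
        using \<gamma> by (simp add: D_def field_simps)
      also have "(D / \<gamma>1 * s + \<gamma>3\<^sup>2 / \<gamma>1 * s + \<gamma>1 * r\<^sup>2 / s + \<gamma>1 * u - 2 * \<gamma>3 * r) / (2 * D)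
          = 1 / (2 * \<gamma>1) * s + w + b * u"
        using \<gamma>(1) D s by (simp add: w_def b_def field_simps power2_eq_square)
      finally have expo: "\<gamma>1 * \<gamma>2 / (2 * D) * (s / \<gamma>1 + (r\<^sup>2 / s + u) / \<gamma>2 - 2 * \<gamma>3 * r / (\<gamma>1 * \<gamma>2))
          = 1 / (2 * \<gamma>1) * s + w + b * u" .
      have "(\<nu> - 1) / 2 - 1 = (\<nu> - 3) / 2" by (simp add: diff_divide_distrib)
      then show ?thesis
        unfolding bivariate_wishart_density_def D_def[symmetric]
        using s True pos det_pos
        by (simp only: prod.case mult_1 det expo c_def[symmetric] K_def minus_add_distrib exp_add powr_mult
           simp_thms if_True) (simp only: mult_ac)
    next
      case False
      then have "s * u \<le> 0"
        using s by (simp add: mult_nonneg_nonpos)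
      then have "\<not> r\<^sup>2 < s * (r\<^sup>2 / s + u)"
        by (simp only: not_less det[symmetric] diff_le_0_iff_le)
      with False show ?thesis by (simp add: bivariate_wishart_density_def)
    qed
  qed
  have const: "K * (Gamma ((\<nu> - 1) / 2) / b powr ((\<nu> - 1) / 2))
     = wishart_marginal_const \<nu> \<gamma>1 \<gamma>2 \<gamma>3 * s powr (\<nu> / 2 - 1) * exp (- (1 / (2 * \<gamma>1) * s))
      * normal_density (\<gamma>3 / \<gamma>1 * s) (sqrt (D * s / \<gamma>1)) r"
  proof -
    have v: "(sqrt (D * s / \<gamma>1))\<^sup>2 = D * s / \<gamma>1"
      using D s \<gamma> by simp
    have sq: "sqrt (2 * pi * (D * s / \<gamma>1)) = sqrt (2 * pi * D / \<gamma>1) * sqrt s"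
      by (simp add: real_sqrt_mult[symmetric])
    \<comment> \<open>The normal normaliser carries the inverse root of \<open>s\<close>;
      compensating for it raises the exponent from \<open>(\<nu> - 3) / 2\<close> to
      \<open>\<nu> / 2 - 1\<close>, which is a gamma shape of \<open>\<nu> / 2\<close>.\<close>
    have "s powr (\<nu> / 2 - 1) = s powr ((\<nu> - 3) / 2) * s powr (1 / 2)"
      by (simp add: powr_add[symmetric] diff_divide_distrib)
    then have ss: "s powr (\<nu> / 2 - 1) = s powr ((\<nu> - 3) / 2) * sqrt s"
      using s by (simp add: powr_half_sqrt)
    show ?thesis
      unfolding wishart_marginal_const_def normal_density_def D_def[symmetric] c_def[symmetric] b_def[symmetric] v ss sq K_def w_def
      using D \<gamma> s by simp
  qed
  have "(\<integral>\<^sup>+t. ennreal (bivariate_wishart_density \<nu> \<gamma>1 \<gamma>2 \<gamma>3 (s, t, r)) \<partial>lborel)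
     = (\<integral>\<^sup>+u. ennreal (bivariate_wishart_density \<nu> \<gamma>1 \<gamma>2 \<gamma>3 (s, r\<^sup>2 / s + 1 * u, r)) \<partial>lborel)"
    using nn_integral_real_affine[OF meas, of 1 "r\<^sup>2 / s"] by simp
  also have "\<dots> = (\<integral>\<^sup>+u. ennreal K * ennreal (?k u) \<partial>lborel)"
    unfolding eq using K by (intro nn_integral_cong ennreal_mult) auto
  also have "\<dots> = ennreal (K * (Gamma ((\<nu> - 1) / 2) / b powr ((\<nu> - 1) / 2)))"
    using \<nu> b K by (subst nn_integral_cmult) (simp_all only: nn_integral_gamma_kernel ennreal_mult', auto simp: nn_integral_gamma_kernel)
  finally show ?thesis
    unfolding const using s by (simp add: D_def)
qed

text \<open>The joint law of \<open>T\<close> and \<open>R\<close> takes a single integration over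
  \<open>s\<close>, which is the integral over \<open>t\<close> with the diagonal entries exchanged.
  The law of \<open>S\<close> takes two, the second being the total mass of the normal
  factor.\<close>

lemma (in prob_space) bivariate_wishart_marginals:
  assumes D: "distributed M lborel (\<lambda>\<omega>. (S \<omega>, T \<omega>, R \<omega>))
      (\<lambda>z. ennreal (bivariate_wishart_density \<nu> \<gamma>1 \<gamma>2 \<gamma>3 z))"
    and \<gamma>: "\<gamma>1 > 0" "\<gamma>2 > 0" "\<gamma>1 * \<gamma>2 > \<gamma>3\<^sup>2" and \<nu>: "\<nu> > 1"
  shows "distributed M lborel S (\<lambda>s. ennreal (if 0 < s then
      wishart_marginal_const \<nu> \<gamma>1 \<gamma>2 \<gamma>3 * s powr (\<nu> / 2 - 1) * exp (- (1 / (2 * \<gamma>1) * s)) else 0))" (is ?S)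
    and "distributed M lborel (\<lambda>\<omega>. (T \<omega>, R \<omega>)) (\<lambda>z. ennreal ((if 0 < fst z then
        wishart_marginal_const \<nu> \<gamma>2 \<gamma>1 \<gamma>3 * fst z powr (\<nu> / 2 - 1) * exp (- (1 / (2 * \<gamma>2) * fst z)) else 0)
      * normal_density (\<gamma>3 / \<gamma>2 * fst z) (sqrt ((\<gamma>2 * \<gamma>1 - \<gamma>3\<^sup>2) * fst z / \<gamma>2)) (snd z)))" (is ?TR)
proof -
  have D': "distributed M (lborel \<Otimes>\<^sub>M lborel) (\<lambda>\<omega>. (S \<omega>, (T \<omega>, R \<omega>)))
      (\<lambda>z. ennreal (bivariate_wishart_density \<nu> \<gamma>1 \<gamma>2 \<gamma>3 z))"
    using D by (simp add: lborel_prod)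
  have \<gamma>': "\<gamma>2 * \<gamma>1 > \<gamma>3\<^sup>2" using \<gamma> by (simp add: mult.commute)
  note sf = lborel.sigma_finite_measure_axioms
  have "(\<integral>\<^sup>+s. ennreal (bivariate_wishart_density \<nu> \<gamma>1 \<gamma>2 \<gamma>3 (s, z)) \<partial>lborel) =
      ennreal ((if 0 < fst z then
        wishart_marginal_const \<nu> \<gamma>2 \<gamma>1 \<gamma>3 * fst z powr (\<nu> / 2 - 1) * exp (- (1 / (2 * \<gamma>2) * fst z)) else 0)
      * normal_density (\<gamma>3 / \<gamma>2 * fst z) (sqrt ((\<gamma>2 * \<gamma>1 - \<gamma>3\<^sup>2) * fst z / \<gamma>2)) (snd z))" for z
    using nn_integral_bivariate_wishart_density[OF \<gamma>(2,1) \<gamma>' \<nu>, of "fst z" "snd z"]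
    by (simp add: bivariate_wishart_density_commute[of _ \<gamma>2 \<gamma>1])
  with distr_marginal2[OF sf sf D'] show ?TR by simp
  have meas: "(\<lambda>z. ennreal (bivariate_wishart_density \<nu> \<gamma>1 \<gamma>2 \<gamma>3 (s, z)))
      \<in> borel_measurable (lborel \<Otimes>\<^sub>M lborel)" for s
    using measurable_compose[OF measurable_Pair1' distributed_borel_measurable[OF D'], of s]
    by (simp add: lborel_prod)
  have C: "wishart_marginal_const \<nu> \<gamma>1 \<gamma>2 \<gamma>3 \<ge> 0"
    using \<gamma> \<nu> by (simp add: wishart_marginal_const_def less_imp_le)
  have "(\<integral>\<^sup>+z. ennreal (bivariate_wishart_density \<nu> \<gamma>1 \<gamma>2 \<gamma>3 (s, z)) \<partial>lborel) = ennreal (if 0 < s then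
      wishart_marginal_const \<nu> \<gamma>1 \<gamma>2 \<gamma>3 * s powr (\<nu> / 2 - 1) * exp (- (1 / (2 * \<gamma>1) * s)) else 0)"
    (is "?l = ennreal ?g") for s
  proof -
    \<comment> \<open>Tonelli with \<open>t\<close> innermost, so that the closed form for fixed
      \<open>s\<close> and \<open>r\<close> applies.\<close>
    have "?l = (\<integral>\<^sup>+r. (\<integral>\<^sup>+t. ennreal (bivariate_wishart_density \<nu> \<gamma>1 \<gamma>2 \<gamma>3 (s, t, r)) \<partial>lborel) \<partial>lborel)"
      by (simp add: lborel_pair.nn_integral_snd[OF meas] lborel_prod)
    also have "\<dots> = (\<integral>\<^sup>+r. ennreal ?g * ennreal (normal_density (\<gamma>3 / \<gamma>1 * s) (sqrt ((\<gamma>1 * \<gamma>2 - \<gamma>3\<^sup>2) * s / \<gamma>1)) r) \<partial>lborel)"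
      unfolding nn_integral_bivariate_wishart_density[OF \<gamma> \<nu>] using C
      by (intro nn_integral_cong ennreal_mult) auto
    also have "\<dots> = ennreal ?g * (\<integral>\<^sup>+r. ennreal (normal_density (\<gamma>3 / \<gamma>1 * s) (sqrt ((\<gamma>1 * \<gamma>2 - \<gamma>3\<^sup>2) * s / \<gamma>1)) r) \<partial>lborel)"
      by (rule nn_integral_cmult) simp
    also have "\<dots> = ennreal ?g"
    proof (cases "0 < s")
      case True
      then have "0 < sqrt ((\<gamma>1 * \<gamma>2 - \<gamma>3\<^sup>2) * s / \<gamma>1)" using \<gamma> by simp
      then show ?thesis by (subst nn_integral_eq_integral) auto
    qed simp
    finally show ?thesis .
  qed
  with distr_marginal1[OF sf sf D'] show ?S by simp
qed

lemma (in prob_space)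
  assumes D: "distributed M lborel (\<lambda>\<omega>. (S \<omega>, T \<omega>, R \<omega>))
      (\<lambda>z. ennreal (bivariate_wishart_density \<nu> \<gamma>1 \<gamma>2 \<gamma>3 z))"
    and \<gamma>: "\<gamma>1 > 0" "\<gamma>2 > 0" "\<gamma>1 * \<gamma>2 > \<gamma>3\<^sup>2" and \<nu>: "\<nu> > 1"
  shows bivariate_wishart_square_integrable:
      "integrable M (\<lambda>\<omega>. (S \<omega>)\<^sup>2)" "integrable M (\<lambda>\<omega>. (T \<omega>)\<^sup>2)" "integrable M (\<lambda>\<omega>. (R \<omega>)\<^sup>2)"
    and bivariate_wishart_expectation:
      "expectation S = \<nu> * \<gamma>1" "expectation T = \<nu> * \<gamma>2" "expectation R = \<nu> * \<gamma>3"
proof -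
  have \<gamma>': "\<gamma>2 * \<gamma>1 > \<gamma>3\<^sup>2" using \<gamma> by (simp add: mult.commute)
  have C: "wishart_marginal_const \<nu> \<gamma>1 \<gamma>2 \<gamma>3 \<ge> 0" "wishart_marginal_const \<nu> \<gamma>2 \<gamma>1 \<gamma>3 \<ge> 0"
    using \<gamma> \<gamma>' \<nu> by (simp_all add: wishart_marginal_const_def less_imp_le)
  have pos: "0 < \<nu> / 2" "0 < 1 / (2 * \<gamma>1)" "0 < 1 / (2 * \<gamma>2)" using \<gamma> \<nu> by auto
  note marg = bivariate_wishart_marginals[OF D \<gamma> \<nu>]
  \<comment> \<open>The gamma mean is shape over rate: \<open>\<nu> / 2\<close> divided by
    \<open>1 / (2 * \<gamma>1)\<close>.\<close>
  show S2: "integrable M (\<lambda>\<omega>. (S \<omega>)\<^sup>2)" and "expectation S = \<nu> * \<gamma>1"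
    using gamma_power_integrable[OF marg(1) pos(1,2) C(1), of 2] gamma_expectation[OF marg(1) pos(1,2) C(1)]
    by auto
  let ?g = "\<lambda>t. if 0 < t then wishart_marginal_const \<nu> \<gamma>2 \<gamma>1 \<gamma>3 * t powr (\<nu> / 2 - 1) * exp (- (1 / (2 * \<gamma>2) * t)) else 0"
  let ?\<tau> = "\<lambda>t. sqrt ((\<gamma>2 * \<gamma>1 - \<gamma>3\<^sup>2) * t / \<gamma>2)"
  have TR: "distributed M lborel (\<lambda>\<omega>. (T \<omega>, R \<omega>))
      (\<lambda>z. ennreal (?g (fst z) * normal_density (0 + \<gamma>3 / \<gamma>2 * fst z) (?\<tau> (fst z)) (snd z)))"
    using marg(2) by simp
  have g: "0 \<le> ?g t" and \<tau>: "?g t \<noteq> 0 \<Longrightarrow> 0 < ?\<tau> t" for t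
    using C \<gamma> \<gamma>' by (auto split: if_splits)
  note T = conditional_normal_marginal[OF TR g \<tau>]
  show T2: "integrable M (\<lambda>\<omega>. (T \<omega>)\<^sup>2)" and ET: "expectation T = \<nu> * \<gamma>2"
    using gamma_power_integrable[OF T pos(1,3) C(2), of 2] gamma_expectation[OF T pos(1,3) C(2)]
    by auto
  have "(\<lambda>\<omega>. (S \<omega>, T \<omega>, R \<omega>)) \<in> borel_measurable M"
    using distributed_measurable[OF D] by simp
  from measurable_compose[OF this, of "\<lambda>z. snd (snd z)" borel]
  have R[measurable]: "R \<in> borel_measurable M"
    by (simp add: borel_prod[symmetric])
  \<comment> \<open>The density vanishes unless the determinant is positive, so the off-diagonal
    entry is almost surely controlled by the diagonal ones.\<close>
  have "AE \<omega> in M. (case (S \<omega>, T \<omega>, R \<omega>) of (s, t, r) \<Rightarrow> r\<^sup>2 \<le> s * t)"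
  proof (subst distributed_AE2[OF D])
    show "Measurable.pred lborel (\<lambda>(s::real, t, r). r\<^sup>2 \<le> s * t)"
      by (simp add: borel_prod[symmetric])
    show "AE z in lborel. 0 < ennreal (bivariate_wishart_density \<nu> \<gamma>1 \<gamma>2 \<gamma>3 z) \<longrightarrow> (case z of (s, t, r) \<Rightarrow> r\<^sup>2 \<le> s * t)"
      by (auto simp: bivariate_wishart_density_def split: if_splits)
  qed
  then have bound: "AE \<omega> in M. norm ((R \<omega>)\<^sup>2) \<le> norm ((S \<omega>)\<^sup>2 + (T \<omega>)\<^sup>2)"
  proof eventually_elim
    case (elim \<omega>)
    then have "(R \<omega>)\<^sup>2 \<le> S \<omega> * T \<omega>" by simp
    also have "\<dots> \<le> (S \<omega>)\<^sup>2 + (T \<omega>)\<^sup>2"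
      using sum_squares_bound[of "S \<omega>" "T \<omega>"] zero_le_power2[of "S \<omega>"] zero_le_power2[of "T \<omega>"] by linarith
    finally show ?case by simp
  qed
  show R2: "integrable M (\<lambda>\<omega>. (R \<omega>)\<^sup>2)"
    by (rule Bochner_Integration.integrable_bound[OF _ _ bound]) (use S2 T2 in auto)
  have "integrable M R"
    using square_integrable_imp_integrable[OF R R2] .
  \<comment> \<open>With constant test function 1 the tower property gives the mean of
    \<open>\<gamma>3 / \<gamma>2 * T\<close>, where \<open>T\<close> has mean
    \<open>\<nu> * \<gamma>2\<close>.\<close>
  then show "expectation R = \<nu> * \<gamma>3"
    using conditional_normal_expectation[OF TR g \<tau>, of "\<lambda>_. 1"] ET \<gamma> by simp
qed

section \<open>Consistency of the estimators\<close>

theorem theorem1: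
  fixes M :: "'a measure"
    and \<mu>x \<mu>y \<sigma>x \<sigma>y \<rho> \<gamma>1 \<gamma>2 \<gamma>3 \<nu> :: real
    and \<Theta>1x \<Theta>1y \<Theta>2x \<Theta>2y \<Theta>2xy :: "nat \<Rightarrow> 'a \<Rightarrow> real"
  assumes "prob_space M"
    and "\<sigma>x > 0" and "\<sigma>y > 0" and "\<bar>\<rho>\<bar> < 1"
    and "\<gamma>1 > 0" and "\<gamma>2 > 0" and "\<gamma>1 * \<gamma>2 > \<gamma>3\<^sup>2"
    and "\<nu> > 2"
    and normal: "\<And>i. i \<ge> 1 \<Longrightarrow> distributed M lborel (\<lambda>\<omega>. (\<Theta>1x i \<omega>, \<Theta>1y i \<omega>))
           (\<lambda>z. ennreal (bivariate_normal_density \<mu>x \<mu>y \<sigma>x \<sigma>y \<rho> z))"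
    and wishart: "\<And>i. i \<ge> 1 \<Longrightarrow> distributed M lborel (\<lambda>\<omega>. (\<Theta>2x i \<omega>, \<Theta>2y i \<omega>, \<Theta>2xy i \<omega>))
           (\<lambda>z. ennreal (bivariate_wishart_density \<nu> \<gamma>1 \<gamma>2 \<gamma>3 z))"
    and indep_components: "\<And>i. i \<ge> 1 \<Longrightarrow> independent_pair M
           borel (\<lambda>\<omega>. (\<Theta>1x i \<omega>, \<Theta>1y i \<omega>))
           borel (\<lambda>\<omega>. (\<Theta>2x i \<omega>, \<Theta>2y i \<omega>, \<Theta>2xy i \<omega>))"
    and indep_sample: "prob_space.indep_vars M (\<lambda>_. borel)
           (\<lambda>i \<omega>. ((\<Theta>1x i \<omega>, \<Theta>1y i \<omega>), (\<Theta>2x i \<omega>, \<Theta>2y i \<omega>, \<Theta>2xy i \<omega>))) {1..}"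
  shows "(converges_in_probability M (mean_hat \<Theta>1x) (\<lambda>_. \<mu>x) \<and>
          converges_in_probability M (mean_hat \<Theta>1y) (\<lambda>_. \<mu>y)) \<and>
         (converges_in_probability M (variance_hat \<Theta>1x) (\<lambda>_. \<sigma>x\<^sup>2) \<and>
          converges_in_probability M (variance_hat \<Theta>1y) (\<lambda>_. \<sigma>y\<^sup>2) \<and>
          converges_in_probability M (correlation_hat \<Theta>1x \<Theta>1y) (\<lambda>_. \<rho>)) \<and>
         (converges_in_probability M (wishart_scale_hat \<nu> \<Theta>2x) (\<lambda>_. \<gamma>1) \<and>
          converges_in_probability M (wishart_scale_hat \<nu> \<Theta>2y) (\<lambda>_. \<gamma>2) \<and>
          converges_in_probability M (wishart_scale_hat \<nu> \<Theta>2xy) (\<lambda>_. \<gamma>3))"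
proof -
  interpret prob_space M by fact
  note M = \<open>prob_space M\<close>
  note \<sigma> = \<open>\<sigma>x > 0\<close> \<open>\<sigma>y > 0\<close>
  have "\<nu> > 1" using \<open>\<nu> > 2\<close> by simp
  \<comment> \<open>Independence over the sample is given for whole observations; composing with a
    projection passes it on to any Borel function of one component.\<close>
  have indep1: "indep_vars (\<lambda>_. borel) (\<lambda>i \<omega>. h (\<Theta>1x i \<omega>, \<Theta>1y i \<omega>)) {1..}"
    if "h \<in> borel_measurable borel" for h :: "real \<times> real \<Rightarrow> real"
    using indep_vars_compose2[OF indep_sample, of "\<lambda>_ z. h (fst z)" "\<lambda>_. borel"] that
    by (simp add: borel_prod[symmetric])
  have indep2: "indep_vars (\<lambda>_. borel) (\<lambda>i \<omega>. h (\<Theta>2x i \<omega>, \<Theta>2y i \<omega>, \<Theta>2xy i \<omega>)) {1..}"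
    if "h \<in> borel_measurable borel" for h :: "real \<times> real \<times> real \<Rightarrow> real"
    using indep_vars_compose2[OF indep_sample, of "\<lambda>_ z. h (snd z)" "\<lambda>_. borel"] that
    by (simp add: borel_prod[symmetric])
  note consistent1 = sample_mean_consistent[OF normal _ indep1]
  note consistent2 = sample_mean_consistent[OF wishart _ indep2]
  note marg = bivariate_normal_marginals[OF normal \<sigma> \<open>\<bar>\<rho>\<bar> < 1\<close>]
  have intx: "integrable M (\<lambda>\<omega>. \<Theta>1x i \<omega> ^ k)" and inty: "integrable M (\<lambda>\<omega>. \<Theta>1y i \<omega> ^ k)" if "i \<ge> 1" for i k
    using normal_power_integrable[OF marg(1)] normal_power_integrable[OF marg(2)] \<sigma> that by auto
  have Ex: "expectation (\<Theta>1x i) = \<mu>x" and Ey: "expectation (\<Theta>1y i) = \<mu>y" if "i \<ge> 1" for i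
    using normal_distributed_expectation[OF \<sigma>(1) marg(1)] normal_distributed_expectation[OF \<sigma>(2) marg(2)] \<sigma> that by auto
  have Exx: "expectation (\<lambda>\<omega>. (\<Theta>1x i \<omega>)\<^sup>2) = \<sigma>x\<^sup>2 + \<mu>x\<^sup>2"
    and Eyy: "expectation (\<lambda>\<omega>. (\<Theta>1y i \<omega>)\<^sup>2) = \<sigma>y\<^sup>2 + \<mu>y\<^sup>2" if "i \<ge> 1" for i
    using normal_distributed_variance[OF \<sigma>(1) marg(1)] normal_distributed_variance[OF \<sigma>(2) marg(2)]
      variance_eq[of "\<Theta>1x i"] variance_eq[of "\<Theta>1y i"]
      intx[of i 1] intx[of i 2] inty[of i 1] inty[of i 2] Ex Ey that by auto
  have x: "converges_in_probability M (mean_hat \<Theta>1x) (\<lambda>_. \<mu>x)"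
    using consistent1[where h=fst and m=\<mu>x] intx Ex by (simp add: borel_prod[symmetric])
  have y: "converges_in_probability M (mean_hat \<Theta>1y) (\<lambda>_. \<mu>y)"
    using consistent1[where h=snd and m=\<mu>y] inty Ey by (simp add: borel_prod[symmetric])
  \<comment> \<open>Averaging squares calls for square-integrable squares, hence the fourth
    moment.\<close>
  have "converges_in_probability M (mean_hat (\<lambda>i \<omega>. (\<Theta>1x i \<omega>)\<^sup>2)) (\<lambda>_. \<sigma>x\<^sup>2 + \<mu>x\<^sup>2)"
    using consistent1[where h="\<lambda>z. (fst z)\<^sup>2" and m="\<sigma>x\<^sup>2 + \<mu>x\<^sup>2"] intx[of _ 4] Exx
    by (simp add: borel_prod[symmetric])
  with converges_in_probability_covariance_hat[OF M _ x x, of "\<sigma>x\<^sup>2 + \<mu>x\<^sup>2"]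
  have xx: "converges_in_probability M (variance_hat \<Theta>1x) (\<lambda>_. \<sigma>x\<^sup>2)"
    by (simp add: variance_hat_eq power2_eq_square)
  have "converges_in_probability M (mean_hat (\<lambda>i \<omega>. (\<Theta>1y i \<omega>)\<^sup>2)) (\<lambda>_. \<sigma>y\<^sup>2 + \<mu>y\<^sup>2)"
    using consistent1[where h="\<lambda>z. (snd z)\<^sup>2" and m="\<sigma>y\<^sup>2 + \<mu>y\<^sup>2"] inty[of _ 4] Eyy
    by (simp add: borel_prod[symmetric])
  with converges_in_probability_covariance_hat[OF M _ y y, of "\<sigma>y\<^sup>2 + \<mu>y\<^sup>2"]
  have yy: "converges_in_probability M (variance_hat \<Theta>1y) (\<lambda>_. \<sigma>y\<^sup>2)"
    by (simp add: variance_hat_eq power2_eq_square)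
  have "converges_in_probability M (mean_hat (\<lambda>i \<omega>. \<Theta>1x i \<omega> * \<Theta>1y i \<omega>)) (\<lambda>_. \<rho> * \<sigma>x * \<sigma>y + \<mu>x * \<mu>y)"
    using consistent1[where h="\<lambda>z. fst z * snd z" and m="\<rho> * \<sigma>x * \<sigma>y + \<mu>x * \<mu>y"]
      bivariate_normal_product_square_integrable[OF normal \<sigma> \<open>\<bar>\<rho>\<bar> < 1\<close>]
      bivariate_normal_product_expectation[OF normal \<sigma> \<open>\<bar>\<rho>\<bar> < 1\<close>]
    by (simp add: borel_prod[symmetric])
  from converges_in_probability_covariance_hat[OF M this x y]
  have "converges_in_probability M (covariance_hat \<Theta>1x \<Theta>1y) (\<lambda>_. \<rho> * \<sigma>x * \<sigma>y)"
    by simp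
  \<comment> \<open>The limiting denominator is the root of
    \<open>\<sigma>y\<^sup>2 * \<sigma>x\<^sup>2\<close>, which is
    \<open>\<sigma>y * \<sigma>x\<close> by positivity and cancels.\<close>
  from converges_in_probability_correlation_hat[OF M this xx yy] \<sigma>
  have xy: "converges_in_probability M (correlation_hat \<Theta>1x \<Theta>1y) (\<lambda>_. \<rho>)"
    by (simp add: real_sqrt_mult)
  note int2 = bivariate_wishart_square_integrable[OF wishart \<open>\<gamma>1 > 0\<close> \<open>\<gamma>2 > 0\<close> \<open>\<gamma>1 * \<gamma>2 > \<gamma>3\<^sup>2\<close> \<open>\<nu> > 1\<close>]
  note E2 = bivariate_wishart_expectation[OF wishart \<open>\<gamma>1 > 0\<close> \<open>\<gamma>2 > 0\<close> \<open>\<gamma>1 * \<gamma>2 > \<gamma>3\<^sup>2\<close> \<open>\<nu> > 1\<close>]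
  have "converges_in_probability M (mean_hat \<Theta>2x) (\<lambda>_. \<nu> * \<gamma>1)"
    using consistent2[where h=fst and m="\<nu> * \<gamma>1"] int2(1) E2(1) by (simp add: borel_prod[symmetric])
  moreover have "converges_in_probability M (mean_hat \<Theta>2y) (\<lambda>_. \<nu> * \<gamma>2)"
    using consistent2[where h="\<lambda>z. fst (snd z)" and m="\<nu> * \<gamma>2"] int2(2) E2(2) by (simp add: borel_prod[symmetric])
  moreover have "converges_in_probability M (mean_hat \<Theta>2xy) (\<lambda>_. \<nu> * \<gamma>3)"
    using consistent2[where h="\<lambda>z. snd (snd z)" and m="\<nu> * \<gamma>3"] int2(3) E2(3) by (simp add: borel_prod[symmetric])
  ultimately show ?thesis
    using x y xx yy xy \<open>\<nu> > 2\<close> by (simp add: converges_in_probability_wishart_scale_hat[OF M])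
qed

end
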